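(* Let $Q = Q_b = (b,a,-b)$, i.e. $Q(X,Y) = bX^2 + aXY - bY^2$ with $a,b \in \mathbb{Z}$, be a quadratic form with discriminant $m = a^2 + 4b^2$. If the equation $$Q(r,s) = b r^2 + a r s - b s^2 = 2x^2$$ has a solution $(r,s,x)$ in nonzero integers, then $$\alpha = 2x(1+i), \qquad \beta = r + si, \qquad \gamma = s + ri$$ satisfy the equation $$\alpha^2 - (a+2bi)\beta^2 - (a-2bi)\gamma^2 = 0.$$ Moreover, $\gcd(r,s) \mid \gcd(\alpha,\beta)$.
   Context: Here $i = \sqrt{-1}$; $\gcd(\alpha,\beta)$ and the divisibility $\gcd(r,s) \mid \gcd(\alpha,\beta)$ are taken in $\mathbb{Z}[i]$. *)

theory Defs
  imports "HOL-Computational_Algebra.Computational_Algebra"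
begin

section \<open>Gaussian integers\<close>

text \<open>\<open>Gauss x y\<close> stands for \<open>x + y i\<close>; see \<open>Gauss_eq\<close> below.\<close>

datatype gauss_int = Gauss (gRe: int) (gIm: int)

lemma gauss_eq_iff: "z = w \<longleftrightarrow> gRe z = gRe w \<and> gIm z = gIm w"
  by (cases z; cases w) auto

instantiation gauss_int :: comm_ring_1
begin

definition "0 = Gauss 0 0"
definition "1 = Gauss 1 0"
definition "z + w = Gauss (gRe z + gRe w) (gIm z + gIm w)"
definition "- z = Gauss (- gRe z) (- gIm z)"
definition "z - w = Gauss (gRe z - gRe w) (gIm z - gIm w)"
definition "z * w = Gauss (gRe z * gRe w - gIm z * gIm w) (gRe z * gIm w + gIm z * gRe w)"

instance
  by standard
    (simp_all add: zero_gauss_int_def one_gauss_int_def plus_gauss_int_def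
      uminus_gauss_int_def minus_gauss_int_def times_gauss_int_def algebra_simps)

end

lemma gRe_simps [simp]:
  "gRe 0 = 0" "gRe 1 = 1" "gRe (z + w) = gRe z + gRe w" "gRe (- z) = - gRe z"
  "gRe (z - w) = gRe z - gRe w" "gRe (z * w) = gRe z * gRe w - gIm z * gIm w"
  by (simp_all add: zero_gauss_int_def one_gauss_int_def plus_gauss_int_def
      uminus_gauss_int_def minus_gauss_int_def times_gauss_int_def)

lemma gIm_simps [simp]:
  "gIm 0 = 0" "gIm 1 = 0" "gIm (z + w) = gIm z + gIm w" "gIm (- z) = - gIm z"
  "gIm (z - w) = gIm z - gIm w" "gIm (z * w) = gRe z * gIm w + gIm z * gRe w"
  by (simp_all add: zero_gauss_int_def one_gauss_int_def plus_gauss_int_def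
      uminus_gauss_int_def minus_gauss_int_def times_gauss_int_def)

lemma gauss_of_nat [simp]: "gRe (of_nat n) = int n" "gIm (of_nat n) = 0"
  by (induction n) simp_all

lemma gauss_of_int [simp]: "gRe (of_int k) = k" "gIm (of_int k) = 0"
  by (cases k; simp)+

lemma gauss_numeral [simp]: "gRe (numeral n) = numeral n" "gIm (numeral n) = 0"
  using gauss_of_int [of "numeral n"] by simp_all

definition gauss_i :: gauss_int
  where "gauss_i = Gauss 0 1"

lemma gauss_i_simps [simp]: "gRe gauss_i = 0" "gIm gauss_i = 1"
  by (simp_all add: gauss_i_def)

lemma gauss_i_squared: "gauss_i ^ 2 = - 1"
  by (simp add: gauss_eq_iff power2_eq_square)

lemma Gauss_eq: "Gauss x y = of_int x + of_int y * gauss_i"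
  by (simp add: gauss_eq_iff)

definition gauss_norm :: "gauss_int \<Rightarrow> int"
  where "gauss_norm z = (gRe z)\<^sup>2 + (gIm z)\<^sup>2"

definition gauss_cnj :: "gauss_int \<Rightarrow> gauss_int"
  where "gauss_cnj z = Gauss (gRe z) (- gIm z)"

lemma gauss_cnj_simps [simp]: "gRe (gauss_cnj z) = gRe z" "gIm (gauss_cnj z) = - gIm z"
  by (simp_all add: gauss_cnj_def)

lemma gauss_norm_0 [simp]: "gauss_norm 0 = 0"
  by (simp add: gauss_norm_def)

lemma gauss_norm_1 [simp]: "gauss_norm 1 = 1"
  by (simp add: gauss_norm_def)

lemma gauss_norm_nonneg [simp]: "gauss_norm z \<ge> 0"
  by (simp add: gauss_norm_def)

lemma gauss_norm_eq_0_iff [simp]: "gauss_norm z = 0 \<longleftrightarrow> z = 0"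
  by (simp add: gauss_norm_def gauss_eq_iff sum_power2_eq_zero_iff)

lemma gauss_norm_pos_iff [simp]: "gauss_norm z > 0 \<longleftrightarrow> z \<noteq> 0"
  using gauss_norm_nonneg [of z] gauss_norm_eq_0_iff [of z] by linarith

lemma gauss_norm_mult: "gauss_norm (z * w) = gauss_norm z * gauss_norm w"
  by (simp add: gauss_norm_def power2_eq_square algebra_simps)

lemma gauss_norm_cnj [simp]: "gauss_norm (gauss_cnj z) = gauss_norm z"
  by (simp add: gauss_norm_def)

lemma mult_gauss_cnj: "z * gauss_cnj z = of_int (gauss_norm z)"
  by (simp add: gauss_eq_iff gauss_norm_def power2_eq_square)

instance gauss_int :: idom
proof
  fix z w :: gauss_int
  assume "z \<noteq> 0" "w \<noteq> 0"
  then have "gauss_norm (z * w) \<noteq> 0"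
    by (simp add: gauss_norm_mult)
  then show "z * w \<noteq> 0"
    by auto
qed

lemma gauss_unit_cases:
  assumes "z dvd (1 :: gauss_int)"
  obtains "z = 1" | "z = - 1" | "z = gauss_i" | "z = - gauss_i"
proof -
  from assms obtain w where "1 = z * w"
    by (elim dvdE)
  then have "gauss_norm z * gauss_norm w = 1"
    by (metis gauss_norm_mult gauss_norm_1)
  then have n: "(gRe z)\<^sup>2 + (gIm z)\<^sup>2 = 1"
    using gauss_norm_nonneg [of z] unfolding zmult_eq_1_iff gauss_norm_def by linarith
  have "(gRe z)\<^sup>2 \<le> 1" "(gIm z)\<^sup>2 \<le> 1"
    using n zero_le_power2 [of "gRe z"] zero_le_power2 [of "gIm z"] by linarith+
  then have "\<bar>gRe z\<bar> \<le> 1" "\<bar>gIm z\<bar> \<le> 1"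
    by (simp_all add: abs_square_le_1)
  then have "gRe z \<in> {-1, 0, 1}" "gIm z \<in> {-1, 0, 1}"
    by auto
  with n show thesis
    by (auto simp: gauss_eq_iff intro: that)
qed

text \<open>
  Division rounds both coordinates of the exact quotient to a nearest integer. The unit factor
  is chosen such that normalized elements lie in the half-open quadrant \<open>Re > 0\<close>, \<open>Im \<ge> 0\<close>.
\<close>

instantiation gauss_int :: "{normalization_euclidean_semiring, euclidean_ring}"
begin

definition divide_gauss_int :: "gauss_int \<Rightarrow> gauss_int \<Rightarrow> gauss_int" where
  "z div w = (let n = gauss_norm w; u = z * gauss_cnj w
     in Gauss ((2 * gRe u + n) div (2 * n)) ((2 * gIm u + n) div (2 * n)))"

definition modulo_gauss_int :: "gauss_int \<Rightarrow> gauss_int \<Rightarrow> gauss_int" where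
  "modulo_gauss_int z w = z - z div w * w"

definition euclidean_size_gauss_int :: "gauss_int \<Rightarrow> nat" where
  "euclidean_size z = nat (gauss_norm z)"

definition unit_factor_gauss_int :: "gauss_int \<Rightarrow> gauss_int" where
  "unit_factor z =
     (if z = 0 then 0
      else if gRe z > 0 \<and> gIm z \<ge> 0 then 1
      else if gRe z \<le> 0 \<and> gIm z > 0 then gauss_i
      else if gRe z < 0 \<and> gIm z \<le> 0 then - 1
      else - gauss_i)"

definition normalize_gauss_int :: "gauss_int \<Rightarrow> gauss_int" where
  "normalize z = gauss_cnj (unit_factor z) * z"

instance
proof
  fix a b :: gauss_int
  show "a div 0 = 0"
    by (simp add: divide_gauss_int_def zero_gauss_int_def)
  show "a * b div b = a" if "b \<noteq> 0"
  proof -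
    define n where "n = gauss_norm b"
    have n: "n > 0"
      using that by (simp add: n_def)
    have u: "a * b * gauss_cnj b = a * of_int n"
      by (simp add: n_def mult_gauss_cnj mult.assoc)
    have *: "(2 * (x * n) + n) div (2 * n) = x" for x
    proof -
      have "(2 * (x * n) + n) div (2 * n) = (n + x * (2 * n)) div (2 * n)"
        by (simp add: algebra_simps)
      also have "\<dots> = x + n div (2 * n)"
        using n by (subst div_mult_self1) auto
      finally show ?thesis
        using n by simp
    qed
    show ?thesis
      unfolding divide_gauss_int_def Let_def u n_def [symmetric]
      by (simp add: gauss_eq_iff *)
  qed
  show "a div b * b + a mod b = a"
    by (simp add: modulo_gauss_int_def)
  show "euclidean_size (0 :: gauss_int) = 0"
    by (simp add: euclidean_size_gauss_int_def)
  show "euclidean_size (a mod b) < euclidean_size b" if "b \<noteq> 0"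
  proof -
    define n where "n = gauss_norm b"
    define u where "u = a * gauss_cnj b"
    have n: "n > 0"
      using that by (simp add: n_def)
    have *: "(2 * (x - (2 * x + n) div (2 * n) * n))\<^sup>2 \<le> n\<^sup>2" for x
    proof -
      define q k where "q = (2 * x + n) div (2 * n)" and "k = (2 * x + n) mod (2 * n)"
      have "2 * x + n = 2 * (q * n) + k"
        using div_mult_mod_eq [of "2 * x + n" "2 * n"]
        by (simp only: q_def [symmetric] k_def [symmetric] mult.left_commute)
      moreover have "0 \<le> k" "k < 2 * n"
        using n by (simp_all add: k_def)
      ultimately have "\<bar>2 * (x - q * n)\<bar> \<le> \<bar>n\<bar>"
        using n by (simp add: abs_le_iff algebra_simps)
      then show ?thesis
        by (simp only: abs_le_square_iff q_def)
    qed
    have "(a mod b) * gauss_cnj b = u - a div b * of_int n"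
      by (simp add: modulo_gauss_int_def u_def n_def mult_gauss_cnj [symmetric] algebra_simps)
    then have "gauss_norm (a mod b) * n = gauss_norm (u - a div b * of_int n)"
      by (metis gauss_norm_mult gauss_norm_cnj n_def)
    moreover have "4 * gauss_norm (u - a div b * of_int n)
        = (2 * (gRe u - (2 * gRe u + n) div (2 * n) * n))\<^sup>2
        + (2 * (gIm u - (2 * gIm u + n) div (2 * n) * n))\<^sup>2"
      unfolding gauss_norm_def power_mult_distrib
      by (simp add: divide_gauss_int_def Let_def u_def [symmetric] n_def [symmetric]
          right_diff_distrib [symmetric] power_mult_distrib del: right_diff_distrib_numeral)
    ultimately have "4 * (gauss_norm (a mod b) * n) \<le> 2 * n\<^sup>2"
      using * [of "gRe u"] * [of "gIm u"] by linarith
    then have "n * (2 * gauss_norm (a mod b)) \<le> n * n"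
      by (simp add: power2_eq_square algebra_simps)
    with n have "2 * gauss_norm (a mod b) \<le> n"
      by simp
    with n have "gauss_norm (a mod b) < n"
      by linarith
    with n show ?thesis
      by (simp add: euclidean_size_gauss_int_def n_def)
  qed
  show "euclidean_size a \<le> euclidean_size (a * b)" if "b \<noteq> 0"
  proof -
    have "gauss_norm a * 1 \<le> gauss_norm a * gauss_norm b"
      using that gauss_norm_pos_iff [of b] by (intro mult_left_mono) (linarith, simp)
    then show ?thesis
      by (simp add: euclidean_size_gauss_int_def gauss_norm_mult nat_mono)
  qed
  show "unit_factor (0 :: gauss_int) = 0"
    by (simp add: unit_factor_gauss_int_def)
  show "unit_factor a = a" if "a dvd 1"
    using that by (rule gauss_unit_cases) (simp_all add: unit_factor_gauss_int_def gauss_eq_iff)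
  show "unit_factor a dvd 1" if "a \<noteq> 0"
  proof -
    have "gauss_i dvd 1"
      by (rule dvdI [of _ _ "- gauss_i"]) (simp add: gauss_eq_iff)
    with that show ?thesis
      by (simp add: unit_factor_gauss_int_def)
  qed
  show "unit_factor (a * b) = a * unit_factor b" if "a dvd 1"
    using that by (rule gauss_unit_cases)
      (simp_all add: unit_factor_gauss_int_def gauss_eq_iff, linarith+)
  show "unit_factor a * normalize a = a"
    by (simp add: normalize_gauss_int_def unit_factor_gauss_int_def gauss_eq_iff)
  show "normalize (0 :: gauss_int) = 0"
    by (simp add: normalize_gauss_int_def)
qed

end

instantiation gauss_int :: euclidean_ring_gcd
begin

definition gcd_gauss_int :: "gauss_int \<Rightarrow> gauss_int \<Rightarrow> gauss_int" where
  "gcd_gauss_int = Euclidean_Algorithm.gcd"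
definition lcm_gauss_int :: "gauss_int \<Rightarrow> gauss_int \<Rightarrow> gauss_int" where
  "lcm_gauss_int = Euclidean_Algorithm.lcm"
definition Gcd_gauss_int :: "gauss_int set \<Rightarrow> gauss_int" where
  "Gcd_gauss_int = Euclidean_Algorithm.Gcd"
definition Lcm_gauss_int :: "gauss_int set \<Rightarrow> gauss_int" where
  "Lcm_gauss_int = Euclidean_Algorithm.Lcm"

instance
  by standard (simp_all add: gcd_gauss_int_def lcm_gauss_int_def Gcd_gauss_int_def Lcm_gauss_int_def)

end


section \<open>Binary quadratic forms over the integers\<close>

text \<open>\<open>QForm A B C\<close> is the form \<open>(A, B, C) = A X\<^sup>2 + B X Y + C Y\<^sup>2\<close>.\<close>

datatype qform = QForm int int int

fun qform_eval :: "qform \<Rightarrow> int \<Rightarrow> int \<Rightarrow> int" where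
  "qform_eval (QForm A B C) X Y = A * X\<^sup>2 + B * X * Y + C * Y\<^sup>2"

fun qform_discr :: "qform \<Rightarrow> int" where
  "qform_discr (QForm A B C) = B\<^sup>2 - 4 * A * C"

end

theory Submission
  imports Defs
begin

text \<open>Since (1+i)^2 = 2i, \<alpha>^2 = 8 x^2 i. As \<gamma> is i times the conjugate of
  \<beta>, the term (a-2bi) \<gamma>^2 is minus the conjugate of w = (a+2bi) \<beta>^2, so the two
  terms add up to 2i Im w = 4i Q(r,s). The left-hand side is thus 4i (2x^2 - Q(r,s)), which
  vanishes. For the divisibility, d = gcd(r,s) satisfies d^2 | Q(r,s) = 2x^2, which forces d | 2x
  and hence d | \<alpha>, while d | \<beta> is immediate.\<close>

lemma of_int_dvd_of_int:
  "d dvd k \<Longrightarrow> (of_int d :: 'a :: comm_ring_1) dvd of_int k"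
  by (auto elim!: dvdE)

theorem lemma12:
  fixes a b m r s x :: int and Q :: qform and \<alpha> \<beta> \<gamma> :: gauss_int
  assumes Q: "Q = QForm b a (- b)"
    and m: "m = qform_discr Q"
    and sol: "qform_eval Q r s = 2 * x\<^sup>2"
    and nonzero: "r \<noteq> 0" "s \<noteq> 0" "x \<noteq> 0"
    and \<alpha>: "\<alpha> = 2 * of_int x * (1 + gauss_i)"
    and \<beta>: "\<beta> = of_int r + of_int s * gauss_i"
    and \<gamma>: "\<gamma> = of_int s + of_int r * gauss_i"
  shows "m = a\<^sup>2 + 4 * b\<^sup>2 \<and>
    \<alpha>\<^sup>2 - (of_int a + 2 * of_int b * gauss_i) * \<beta>\<^sup>2
       - (of_int a - 2 * of_int b * gauss_i) * \<gamma>\<^sup>2 = 0 \<and>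
    of_int (gcd r s) dvd gcd \<alpha> \<beta>"
proof -
  have disc: "m = a\<^sup>2 + 4 * b\<^sup>2"
    using Q m by (simp add: power2_eq_square)
  have form: "b * r\<^sup>2 + a * r * s - b * s\<^sup>2 = 2 * x\<^sup>2"
    using Q sol by simp
  \<comment> \<open>A polynomial identity: it holds for all \<open>a\<close>, \<open>b\<close>,
    \<open>r\<close>, \<open>s\<close>, \<open>x\<close>, and the equation for \<open>x\<close>
    enters only afterwards.\<close>
  have "\<alpha>\<^sup>2 - (of_int a + 2 * of_int b * gauss_i) * \<beta>\<^sup>2
      - (of_int a - 2 * of_int b * gauss_i) * \<gamma>\<^sup>2
    = of_int (4 * (2 * x\<^sup>2 - (b * r\<^sup>2 + a * r * s - b * s\<^sup>2))) * gauss_i"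
    unfolding \<alpha> \<beta> \<gamma> by (simp add: gauss_eq_iff power2_eq_square algebra_simps)
  then have eq: "\<alpha>\<^sup>2 - (of_int a + 2 * of_int b * gauss_i) * \<beta>\<^sup>2
      - (of_int a - 2 * of_int b * gauss_i) * \<gamma>\<^sup>2 = 0"
    by (simp add: form)
  define d where "d = gcd r s"
  have dr: "d dvd r" and ds: "d dvd s"
    by (simp_all add: d_def)
  \<comment> \<open>The form is homogeneous of degree 2; the bracketing \<open>a * (r * s)\<close>
    exposes the product of two multiples of \<open>d\<close>.\<close>
  have "d\<^sup>2 dvd b * r\<^sup>2 + a * (r * s) - b * s\<^sup>2"
    unfolding power2_eq_square
    by (intro dvd_add dvd_diff dvd_mult mult_dvd_mono dr ds)
  then have "d\<^sup>2 dvd 2 * x\<^sup>2"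
    using form by (simp add: mult.assoc)
  \<comment> \<open>Doubling turns the right-hand side into a perfect square, so the squares can be
    cancelled; its root \<open>2 * x\<close> is a factor of \<alpha>.\<close>
  then have "d\<^sup>2 dvd 2 * (2 * x\<^sup>2)"
    by (rule dvd_mult)
  then have "d\<^sup>2 dvd (2 * x)\<^sup>2"
    by (simp add: power_mult_distrib)
  then have "d dvd 2 * x"
    by (subst (asm) pow_divides_pow_iff) simp_all
  then have "of_int d dvd (of_int (2 * x) :: gauss_int)"
    by (rule of_int_dvd_of_int)
  then have "of_int d dvd \<alpha>"
    unfolding \<alpha> by simp
  moreover have "of_int d dvd \<beta>"
    unfolding \<beta> by (intro dvd_add dvd_mult2 of_int_dvd_of_int dr ds)
  ultimately have "of_int (gcd r s) dvd gcd \<alpha> \<beta>"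
    unfolding d_def by (rule gcd_greatest)
  with disc eq show ?thesis
    by blast
qed

end
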